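(* Let $(\mathfrak{g},[\cdot,\cdot])$ be a Leibniz algebra, $(V,\rho^L,\rho^R)$ a representation of it, $H:\mathfrak{g}\otimes\mathfrak{g}\to V$ a $2$-cocycle of $\mathfrak{g}$ with coefficients in $V$, and $K:V\to\mathfrak{g}$ an $H$-twisted relative Rota-Baxter operator. If $Z^1(V,\mathfrak{g})=\partial_K(\mathrm{Nij}(K))$, where $Z^1(V,\mathfrak{g})$ is the space of $1$-cocycles in the cohomology of $K$ and $\mathrm{Nij}(K)$ is the set of Nijenhuis elements associated with $K$, then $K$ is rigid.
   Context: All vector spaces are finite-dimensional over $\mathbb{C}$ (apart from spaces of formal power series). A Leibniz algebra is a vector space $\mathfrak{g}$ with a bilinear bracket satisfying $[x,[y,z]]=[[x,y],z]+[y,[x,z]]$ for all $x,y,z\in\mathfrak{g}$. A representation of $\mathfrak{g}$ is a triple $(V,\rho^L,\rho^R)$ with $V$ a vector space and linear maps $\rho^L,\rho^R:\mathfrak{g}\to gl(V)$ such that for all $x,y\in\mathfrak{g}$: $\rho^L([x,y])=\rho^L(x)\rho^L(y)-\rho^L(y)\rho^L(x)$, $\rho^R([x,y])=\rho^L(x)\rho^R(y)-\rho^R(y)\rho^L(x)$, and $\rho^R([x,y])=\rho^L(x)\rho^R(y)+\rho^R(y)\rho^R(x)$. A $2$-cocycle of $\mathfrak{g}$ with coefficients in $V$ is a bilinear map $H:\mathfrak{g}\otimes\mathfrak{g}\to V$ with $\rho^L(x)H(y,z)-\rho^L(y)H(x,z)-\rho^R(z)H(x,y)-H([x,y],z)-H(y,[x,z])+H(x,[y,z])=0$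 for all $x,y,z\in\mathfrak{g}$. A linear map $K:V\to\mathfrak{g}$ is an $H$-twisted relative Rota-Baxter operator if $[Ku,Kv]=K(\rho^L(Ku)v+\rho^R(Kv)u+H(Ku,Kv))$ for all $u,v\in V$. Cohomology of $K$ in low degrees: $V$ is a Leibniz algebra with bracket $[u,v]_K=\rho^L(Ku)v+\rho^R(Kv)u+H(Ku,Kv)$, and it has a representation on $\mathfrak{g}$ given by $\overline{\rho}^L(u)x=[Ku,x]-K(\rho^R(x)u)-KH(Ku,x)$, $\overline{\rho}^R(u)x=[x,Ku]-K(\rho^L(x)u)-KH(x,Ku)$. The differential $\partial_K$ is the Loday-Pirashvili differential of $(V,[\cdot,\cdot]_K)$ with coefficients in $\mathfrak{g}$; on $C^0(V,\mathfrak{g})=\mathfrak{g}$ it is $(\partial_Kx)(u)=-\overline{\rho}^R(u)x$, and on $C^1(V,\mathfrak{g})=\mathrm{Hom}(V,\mathfrak{g})$ it is $(\partial_Kf)(u,v)=\overline{\rho}^L(u)f(v)+\overline{\rho}^R(v)f(u)-f([u,v]_K)$. $Z^1(V,\mathfrak{g})=\{f\in\mathrm{Hom}(V,\mathfrak{g}):\partial_Kf=0\}$. An element $x\in\mathfrak{g}$ is a Nijenhuis element associated with $K$ if for all $y,z\in\mathfrak{g}$ and $u\in V$: - $[x,\overline{\rho}^R(u)x]=0$; - $[[x,y],[x,z]]=0$; - $H(x,K(\rho^L(y)u))=\rho^L(y)H(x,Ku)$ and $\rho^L([x,y])(\rho^L(x)u+H(x,Ku))=0$; - $H(x,K(\rho^R(y)u))=\rho^R(y)H(x,Ku)$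 and $\rho^R([x,y])(\rho^L(x)u+H(x,Ku))=0$; - $\rho^L(x)H(y,z)+H(x,KH(y,z))=H([x,y],z)+H(y,[x,z])$ and $H([x,y],[x,z])=0$. The bracket of $\mathfrak{g}$, the maps $\rho^L,\rho^R$ and $H$ are extended $\mathbb{C}[[t]]$-bilinearly to $\mathfrak{g}[[t]]$ and $V[[t]]$. A formal deformation of $K$ is a formal sum $K_t=\sum_{i\ge0}K_it^i$ with $K_i\in\mathrm{Hom}(V,\mathfrak{g})$, $K_0=K$ (extended $\mathbb{C}[[t]]$-linearly to $V[[t]]\to\mathfrak{g}[[t]]$), with $[K_tu,K_tv]=K_t(\rho^L(K_tu)v+\rho^R(K_tv)u+H(K_tu,K_tv))$ for all $u,v\in V$. Two formal deformations $K_t,K'_t$ of $K$ are equivalent if there exist $x\in\mathfrak{g}$ and linear maps $\phi_i\in gl(\mathfrak{g})$, $\psi_i\in gl(V)$ ($i\ge2$) such that, with $\phi_t=\mathrm{Id}_{\mathfrak{g}}+t[x,\cdot]+\sum_{i\ge2}\phi_it^i$ and $\psi_t=\mathrm{Id}_V+t(\rho^L(x)+H(x,K(\cdot)))+\sum_{i\ge2}\psi_it^i$ (extended $\mathbb{C}[[t]]$-linearly), one has: $\phi_t$ is a Leibniz algebra morphism of $\mathfrak{g}[[t]]$, $\phi_t\circ K_t=K'_t\circ\psi_t$, $\psi_t(\rho^L(y)u)=\rho^L(\phi_t(y))\psi_t(u)$, $\psi_t(\rho^R(y)u)=\rho^R(\phi_t(y))\psi_t(u)$, and $\psi_t\circ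 H=H\circ(\phi_t\otimes\phi_t)$, for all $y\in\mathfrak{g}$, $u\in V$. $K$ is rigid if every formal deformation of $K$ is equivalent to the undeformed deformation $K'_t=K$. *)

theory Defs
  imports "HOL-Computational_Algebra.Formal_Power_Series"
begin

definition bilinear_map ::
  "(complex \<Rightarrow> 'a::ab_group_add \<Rightarrow> 'a) \<Rightarrow> (complex \<Rightarrow> 'b::ab_group_add \<Rightarrow> 'b) \<Rightarrow>
   (complex \<Rightarrow> 'c::ab_group_add \<Rightarrow> 'c) \<Rightarrow> ('a \<Rightarrow> 'b \<Rightarrow> 'c) \<Rightarrow> bool" where
  "bilinear_map sa sb sc f \<longleftrightarrow>
     (\<forall>x. Vector_Spaces.linear sb sc (\<lambda>y. f x y)) \<and>
     (\<forall>y. Vector_Spaces.linear sa sc (\<lambda>x. f x y))"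

locale leibniz_algebra =
  fixes sg :: "complex \<Rightarrow> 'g::ab_group_add \<Rightarrow> 'g"
    and br :: "'g \<Rightarrow> 'g \<Rightarrow> 'g"
  assumes finite_dim_g: "\<exists>B. finite_dimensional_vector_space sg B"
    and bilinear_br: "bilinear_map sg sg sg br"
    and leibniz: "br x (br y z) = br (br x y) z + br y (br x z)"

text \<open>The linear maps \<open>\<rho>\<^sup>L, \<rho>\<^sup>R\<close> from \<open>\<gg>\<close> to \<open>gl(V)\<close> are given in curried form, hence
  as bilinear maps \<open>rL, rR\<close>.\<close>

locale leibniz_representation = leibniz_algebra sg br
  for sg :: "complex \<Rightarrow> 'g::ab_group_add \<Rightarrow> 'g"
    and br :: "'g \<Rightarrow> 'g \<Rightarrow> 'g" +
  fixes sv :: "complex \<Rightarrow> 'v::ab_group_add \<Rightarrow> 'v"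
    and rL rR :: "'g \<Rightarrow> 'v \<Rightarrow> 'v"
  assumes finite_dim_v: "\<exists>B. finite_dimensional_vector_space sv B"
    and bilinear_rL: "bilinear_map sg sv sv rL"
    and bilinear_rR: "bilinear_map sg sv sv rR"
    and rL_br: "rL (br x y) u = rL x (rL y u) - rL y (rL x u)"
    and rR_br: "rR (br x y) u = rL x (rR y u) - rR y (rL x u)"
    and rR_br': "rR (br x y) u = rL x (rR y u) + rR y (rR x u)"

locale leibniz_2cocycle = leibniz_representation sg br sv rL rR
  for sg :: "complex \<Rightarrow> 'g::ab_group_add \<Rightarrow> 'g"
    and br :: "'g \<Rightarrow> 'g \<Rightarrow> 'g"
    and sv :: "complex \<Rightarrow> 'v::ab_group_add \<Rightarrow> 'v"
    and rL rR :: "'g \<Rightarrow> 'v \<Rightarrow> 'v" +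
  fixes H :: "'g \<Rightarrow> 'g \<Rightarrow> 'v"
  assumes bilinear_H: "bilinear_map sg sg sv H"
    and cocycle_H: "rL x (H y z) - rL y (H x z) - rR z (H x y)
                    - H (br x y) z - H y (br x z) + H x (br y z) = 0"

locale twisted_rota_baxter = leibniz_2cocycle sg br sv rL rR H
  for sg :: "complex \<Rightarrow> 'g::ab_group_add \<Rightarrow> 'g"
    and br :: "'g \<Rightarrow> 'g \<Rightarrow> 'g"
    and sv :: "complex \<Rightarrow> 'v::ab_group_add \<Rightarrow> 'v"
    and rL rR :: "'g \<Rightarrow> 'v \<Rightarrow> 'v"
    and H :: "'g \<Rightarrow> 'g \<Rightarrow> 'v" +
  fixes K :: "'v \<Rightarrow> 'g"
  assumes linear_K: "Vector_Spaces.linear sv sg K"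
    and rota_baxter: "br (K u) (K v) = K (rL (K u) v + rR (K v) u + H (K u) (K v))"

text \<open>The \<open>\<complex>[[t]]\<close>-bilinear extension of a bilinear map (Cauchy product).\<close>

definition fps_bilin ::
  "('a \<Rightarrow> 'b \<Rightarrow> 'c::comm_monoid_add) \<Rightarrow> 'a fps \<Rightarrow> 'b fps \<Rightarrow> 'c fps" where
  "fps_bilin f x y = Abs_fps (\<lambda>n. \<Sum>i\<le>n. f (fps_nth x i) (fps_nth y (n - i)))"

text \<open>The \<open>\<complex>[[t]]\<close>-linear map given by a formal sum \<open>\<Sum>i. F i t^i\<close> of linear maps.
  Elements of \<open>\<gg>\<close> and \<open>V\<close> are embedded below as constant series by \<open>fps_const\<close>.\<close>

definition fps_lin ::
  "(nat \<Rightarrow> 'a \<Rightarrow> 'b::comm_monoid_add) \<Rightarrow> 'a fps \<Rightarrow> 'b fps" where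
  "fps_lin F x = Abs_fps (\<lambda>n. \<Sum>i\<le>n. F i (fps_nth x (n - i)))"

context twisted_rota_baxter
begin

definition brK :: "'v \<Rightarrow> 'v \<Rightarrow> 'v" where
  "brK u v = rL (K u) v + rR (K v) u + H (K u) (K v)"

definition rhoL_bar :: "'v \<Rightarrow> 'g \<Rightarrow> 'g" where
  "rhoL_bar u x = br (K u) x - K (rR x u) - K (H (K u) x)"

definition rhoR_bar :: "'v \<Rightarrow> 'g \<Rightarrow> 'g" where
  "rhoR_bar u x = br x (K u) - K (rL x u) - K (H x (K u))"

text \<open>\<open>d0\<close> and \<open>d1\<close> are the Loday-Pirashvili differential on
  \<open>C\<^sup>0(V,\<gg>) = \<gg>\<close> and on \<open>C\<^sup>1(V,\<gg>) = Hom(V,\<gg>)\<close>.\<close>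

definition d0 :: "'g \<Rightarrow> 'v \<Rightarrow> 'g" where
  "d0 x = (\<lambda>u. - rhoR_bar u x)"

definition d1 :: "('v \<Rightarrow> 'g) \<Rightarrow> 'v \<Rightarrow> 'v \<Rightarrow> 'g" where
  "d1 f = (\<lambda>u v. rhoL_bar u (f v) + rhoR_bar v (f u) - f (brK u v))"

definition Z1 :: "('v \<Rightarrow> 'g) set" where
  "Z1 = {f. Vector_Spaces.linear sv sg f \<and> d1 f = (\<lambda>u v. 0)}"

definition Nij :: "'g set" where
  "Nij = {x. \<forall>y z u.
     br x (rhoR_bar u x) = 0 \<and>
     br (br x y) (br x z) = 0 \<and>
     H x (K (rL y u)) = rL y (H x (K u)) \<and>
     rL (br x y) (rL x u + H x (K u)) = 0 \<and>
     H x (K (rR y u)) = rR y (H x (K u)) \<and>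
     rR (br x y) (rL x u + H x (K u)) = 0 \<and>
     rL x (H y z) + H x (K (H y z)) = H (br x y) z + H y (br x z) \<and>
     H (br x y) (br x z) = 0}"

definition formal_deformation :: "(nat \<Rightarrow> 'v \<Rightarrow> 'g) \<Rightarrow> bool" where
  "formal_deformation Kt \<longleftrightarrow>
     (\<forall>i. Vector_Spaces.linear sv sg (Kt i)) \<and>
     Kt 0 = K \<and>
     (\<forall>u v. let u' = fps_const u; v' = fps_const v; k = fps_lin Kt in
        fps_bilin br (k u') (k v') =
        k (fps_bilin rL (k u') v' + fps_bilin rR (k v') u' + fps_bilin H (k u') (k v')))"

definition equivalent_deformations ::
  "(nat \<Rightarrow> 'v \<Rightarrow> 'g) \<Rightarrow> (nat \<Rightarrow> 'v \<Rightarrow> 'g) \<Rightarrow> bool" where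
  "equivalent_deformations Kt Kt' \<longleftrightarrow>
     (\<exists>x \<phi> \<psi>.
        (\<forall>i\<ge>2. Vector_Spaces.linear sg sg (\<phi> i)) \<and>
        (\<forall>i\<ge>2. Vector_Spaces.linear sv sv (\<psi> i)) \<and>
        \<phi> 0 = (\<lambda>y. y) \<and> \<phi> 1 = (\<lambda>y. br x y) \<and>
        \<psi> 0 = (\<lambda>u. u) \<and> \<psi> 1 = (\<lambda>u. rL x u + H x (K u)) \<and>
        (\<forall>y z. fps_lin \<phi> (fps_bilin br y z) = fps_bilin br (fps_lin \<phi> y) (fps_lin \<phi> z)) \<and>
        fps_lin \<phi> \<circ> fps_lin Kt = fps_lin Kt' \<circ> fps_lin \<psi> \<and>
        (\<forall>y u. fps_lin \<psi> (fps_const (rL y u)) =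
                fps_bilin rL (fps_lin \<phi> (fps_const y)) (fps_lin \<psi> (fps_const u))) \<and>
        (\<forall>y u. fps_lin \<psi> (fps_const (rR y u)) =
                fps_bilin rR (fps_lin \<phi> (fps_const y)) (fps_lin \<psi> (fps_const u))) \<and>
        (\<forall>y z. fps_lin \<psi> (fps_bilin H y z) = fps_bilin H (fps_lin \<phi> y) (fps_lin \<phi> z)))"

definition undeformed :: "nat \<Rightarrow> 'v \<Rightarrow> 'g" where
  "undeformed i = (if i = 0 then K else (\<lambda>u. 0))"

definition rigid :: bool where
  "rigid \<longleftrightarrow> (\<forall>Kt. formal_deformation Kt \<longrightarrow> equivalent_deformations Kt undeformed)"

end

end

theory Submission
  imports Defs
begin

text \<open>Kill the deformation one degree at a time. If \<open>\<phi>\<^sub>t K\<^sub>t = K \<psi>\<^sub>t\<close> holds up to degree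
  \<open>n\<close>, the defect in degree \<open>n + 1\<close> is a 1-cocycle, hence \<open>d0 x\<close> for a Nijenhuis element
  \<open>x\<close>. The Nijenhuis conditions make \<open>1 + t\<^bsup>n+1\<^esup> [x, _]\<close> and
  \<open>1 + t\<^bsup>n+1\<^esup> (\<rho>\<^sup>L x + H x (K _))\<close> respect the bracket, the representation and \<open>H\<close>, and
  composing with them removes the defect. Only the first step reaches degree 1, and the
  infinite composition converges t-adically, so \<open>\<phi>\<^sub>t\<close> and \<open>\<psi>\<^sub>t\<close> have the linear terms
  required of an equivalence.\<close>

section \<open>Cauchy products and formal sums of additive maps\<close>

unbundle fps_syntax

text \<open>The identities between Cauchy products below rest on additivity in each argument, so
  scalars are kept out.\<close>

locale biadditive =
  fixes f :: "'a::ab_group_add \<Rightarrow> 'b::ab_group_add \<Rightarrow> 'c::ab_group_add"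
  assumes additive_left: "additive (\<lambda>x. f x y)"
    and additive_right: "additive (f x)"
begin

lemmas add_left = additive.add[OF additive_left]
  and add_right = additive.add[OF additive_right]
  and diff_left = additive.diff[OF additive_left]
  and diff_right = additive.diff[OF additive_right]
  and zero_left = additive.zero[OF additive_left]
  and zero_right = additive.zero[OF additive_right]

lemma fps_bilin_add_left: "fps_bilin f (x + x') y = fps_bilin f x y + fps_bilin f x' y"
  by (simp add: fps_bilin_def fps_eq_iff add_left sum.distrib)

lemma fps_bilin_add_right: "fps_bilin f x (y + y') = fps_bilin f x y + fps_bilin f x y'"
  by (simp add: fps_bilin_def fps_eq_iff add_right sum.distrib)

lemma fps_bilin_const: "fps_bilin f (fps_const x) (fps_const y) = fps_const (f x y)"
proof (rule fps_ext)
  fix n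
  have "(\<Sum>i\<le>n. f (fps_const x $ i) (fps_const y $ (n - i))) =
        (\<Sum>i\<le>n. if i = 0 then f x (fps_const y $ n) else 0)"
    by (intro sum.cong) (auto simp: zero_left)
  then show "fps_bilin f (fps_const x) (fps_const y) $ n = fps_const (f x y) $ n"
    by (simp add: fps_bilin_def zero_right)
qed

text \<open>In degree \<open>Suc n\<close> a coefficient of degree \<open>Suc n\<close> is paired
  only with a constant one. Every other summand involves degrees 1 to n in both factors, where the
  series agree.\<close>

lemma fps_bilin_perturb_last:
  assumes "\<And>i. i \<le> n \<Longrightarrow> p $ i = q $ i" "\<And>i. i \<le> n \<Longrightarrow> r $ i = s $ i"
  shows "fps_bilin f p r $ Suc n = fps_bilin f q s $ Suc n
    + f (p $ Suc n - q $ Suc n) (s $ 0) + f (q $ 0) (r $ Suc n - s $ Suc n)"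
proof -
  have "fps_bilin f x y $ Suc n = f (x $ 0) (y $ Suc n) +
      (\<Sum>i=1..n. f (x $ i) (y $ (Suc n - i))) + f (x $ Suc n) (y $ 0)" for x y
    by (simp add: fps_bilin_def atMost_atLeast0 sum.atLeast_Suc_atMost)
  moreover have "(\<Sum>i=1..n. f (p $ i) (r $ (Suc n - i))) = (\<Sum>i=1..n. f (q $ i) (s $ (Suc n - i)))"
    using assms by (intro sum.cong) auto
  ultimately show ?thesis
    using assms by (simp add: diff_left diff_right)
qed

end

lemma fps_bilin_flip: "fps_bilin f x y = fps_bilin (\<lambda>y x. f x y) y x"
proof (rule fps_ext)
  fix n
  show "fps_bilin f x y $ n = fps_bilin (\<lambda>y x. f x y) y x $ n"
    unfolding fps_bilin_def fps_nth_Abs_fps atMost_atLeast0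
    by (subst sum.atLeastAtMost_rev) simp
qed

lemma fps_bilin_nth_cong:
  assumes "\<And>i. i \<le> n \<Longrightarrow> x $ i = x' $ i" "\<And>i. i \<le> n \<Longrightarrow> y $ i = y' $ i"
  shows "fps_bilin f x y $ n = fps_bilin f x' y' $ n"
  using assms by (auto simp: fps_bilin_def intro!: sum.cong)

lemma fps_lin_nth_cong:
  assumes "\<And>i. i \<le> n \<Longrightarrow> F i = G i"
  shows "fps_lin F x $ n = fps_lin G x $ n"
  using assms by (auto simp: fps_lin_def intro!: sum.cong)

lemma fps_lin_add:
  assumes "\<And>i. additive (F i)"
  shows "fps_lin F (x + y) = fps_lin F x + fps_lin F y"
  by (simp add: fps_lin_def fps_eq_iff additive.add[OF assms] sum.distrib)

lemma fps_lin_const: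
  assumes "\<And>i. additive (F i)"
  shows "fps_lin F (fps_const u) $ n = F n u"
proof -
  have "(\<Sum>i\<le>n. F i (fps_const u $ (n - i))) = (\<Sum>i\<le>n. if i = n then F n u else 0)"
    by (intro sum.cong) (auto simp: additive.zero[OF assms])
  then show ?thesis by (simp add: fps_lin_def)
qed

text \<open>The degree n coefficient of the composite of the formal sums \<open>F\<close> and
  \<open>G\<close>.\<close>

definition coeff_comp ::
  "(nat \<Rightarrow> 'b \<Rightarrow> 'c::comm_monoid_add) \<Rightarrow> (nat \<Rightarrow> 'a \<Rightarrow> 'b) \<Rightarrow> nat \<Rightarrow> 'a \<Rightarrow> 'c" where
  "coeff_comp F G n u = (\<Sum>i\<le>n. F i (G (n - i) u))"

lemma fps_lin_comp:
  assumes "\<And>i. additive (F i)"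
  shows "fps_lin F (fps_lin G x) = fps_lin (coeff_comp F G) x"
proof (rule fps_ext)
  fix n
  show "fps_lin F (fps_lin G x) $ n = fps_lin (coeff_comp F G) x $ n"
    \<comment> \<open>Both double sums run over i + j + l = n; this is the reindexing behind
      associativity of series multiplication.\<close>
    using fps_mult_assoc_lemma[where k=n and f="\<lambda>i j l. F i (G j (x $ l))" and n=n]
    by (simp add: fps_lin_def coeff_comp_def additive.sum[OF assms] atMost_atLeast0)
qed

section \<open>Perturbations 1 + t^m a of the identity\<close>

definition monomial_map :: "nat \<Rightarrow> ('a \<Rightarrow> 'b::zero) \<Rightarrow> nat \<Rightarrow> 'a \<Rightarrow> 'b" where
  "monomial_map m a i y = (if i = m then a y else 0)"

lemma fps_lin_monomial_map:
  "fps_lin (monomial_map m a) x $ n = (if m \<le> n then a (x $ (n - m)) else 0)"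
  by (simp add: fps_lin_def monomial_map_def)

lemma coeff_comp_monomial_map:
  "coeff_comp (monomial_map m a) F n u = (if m \<le> n then a (F (n - m) u) else 0)"
  by (simp add: coeff_comp_def monomial_map_def)

lemma fps_bilin_monomial_left:
  assumes "biadditive f"
  shows "fps_bilin f (fps_lin (monomial_map m a) x) y $ n =
    (if m \<le> n then fps_bilin (\<lambda>x y. f (a x) y) x y $ (n - m) else 0)"
proof -
  have *: "(\<Sum>i\<le>n. f (fps_lin (monomial_map m a) x $ i) (y $ (n - i))) =
        (\<Sum>i\<in>{i. i \<le> n \<and> m \<le> i}. f (a (x $ (i - m))) (y $ (n - i)))"
    by (rule sum.mono_neutral_cong_right)
       (auto simp: fps_lin_monomial_map biadditive.zero_left[OF assms])
  show ?thesis
  proof (cases "m \<le> n")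
    case True
    have "(\<Sum>i\<in>{i. i \<le> n \<and> m \<le> i}. f (a (x $ (i - m))) (y $ (n - i))) =
        (\<Sum>i\<le>n - m. f (a (x $ i)) (y $ (n - m - i)))"
      by (rule sum.reindex_bij_witness[of _ "\<lambda>i. i + m" "\<lambda>i. i - m"]) (use True in auto)
    with * True show ?thesis by (simp add: fps_bilin_def)
  next
    case False
    then have "{i. i \<le> n \<and> m \<le> i} = {}" by auto
    with * False show ?thesis by (simp add: fps_bilin_def)
  qed
qed

lemma fps_bilin_monomial_right:
  assumes "biadditive f"
  shows "fps_bilin f x (fps_lin (monomial_map m b) y) $ n =
    (if m \<le> n then fps_bilin (\<lambda>x y. f x (b y)) x y $ (n - m) else 0)"
proof -
  \<comment> \<open>Swapping the arguments reduces this to the case of the left factor.\<close>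
  have "biadditive (\<lambda>y x. f x y)"
    using assms by (simp add: biadditive_def)
  from fps_bilin_monomial_left[OF this, of m b y x n] show ?thesis
    by (simp add: fps_bilin_flip[of f] fps_bilin_flip[of "\<lambda>x y. f x (b y)"])
qed

text \<open>After expansion, the terms with a single t^m combine by the derivation rule
  \<open>deriv\<close>, and the t^(2m) term vanishes by \<open>null\<close>. So the compatibility is
  exact, without the higher terms of an exponential.\<close>

lemma fps_bilin_derivation:
  assumes f: "biadditive f" and c: "additive c"
    and deriv: "\<And>x y. c (f x y) = f (a x) y + f x (b y)"
    and null: "\<And>x y. f (a x) (b y) = 0"
  shows "fps_bilin f (x + fps_lin (monomial_map m a) x) (y + fps_lin (monomial_map m b) y) =
    fps_bilin f x y + fps_lin (monomial_map m c) (fps_bilin f x y)"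
proof -
  interpret f: biadditive f by fact
  have "fps_lin (monomial_map m c) (fps_bilin f x y) =
      fps_bilin f (fps_lin (monomial_map m a) x) y + fps_bilin f x (fps_lin (monomial_map m b) y)"
    by (rule fps_ext)
       (simp add: fps_bilin_monomial_left[OF f] fps_bilin_monomial_right[OF f] fps_lin_monomial_map,
        simp add: fps_bilin_def additive.sum[OF c] deriv sum.distrib)
  moreover have "fps_bilin f (fps_lin (monomial_map m a) x) (fps_lin (monomial_map m b) y) = 0"
  proof (rule fps_ext)
    fix n
    have "f (a s) (fps_lin (monomial_map m b) y $ j) = 0" for s j
      by (simp add: fps_lin_monomial_map null f.zero_right)
    then show "fps_bilin f (fps_lin (monomial_map m a) x) (fps_lin (monomial_map m b) y) $ n = 0 $ n"
      by (simp add: fps_bilin_monomial_left[OF f]) (simp add: fps_bilin_def)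
  qed
  ultimately show ?thesis
    by (simp add: f.fps_bilin_add_left f.fps_bilin_add_right algebra_simps)
qed

section \<open>Linear maps and their combinations\<close>

lemma linear_imp_additive: "Vector_Spaces.linear s1 s2 f \<Longrightarrow> additive f"
  by (simp add: Vector_Spaces.linear_iff additive_def)

lemma bilinear_map_imp_biadditive: "bilinear_map sa sb sc f \<Longrightarrow> biadditive f"
  unfolding bilinear_map_def biadditive_def by (blast intro: linear_imp_additive)

lemma linear_add:
  "\<lbrakk>Vector_Spaces.linear s1 s2 f; Vector_Spaces.linear s1 s2 g\<rbrakk>
    \<Longrightarrow> Vector_Spaces.linear s1 s2 (\<lambda>x. f x + g x)"
  by (simp add: Vector_Spaces.linear_iff vector_space.vector_space_assms(1))

lemma linear_sub:
  "\<lbrakk>Vector_Spaces.linear s1 s2 f; Vector_Spaces.linear s1 s2 g\<rbrakk>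
    \<Longrightarrow> Vector_Spaces.linear s1 s2 (\<lambda>x. f x - g x)"
  by (simp add: Vector_Spaces.linear_iff vector_space.vector_space_assms(1) module.scale_right_diff_distrib flip: module_iff_vector_space)

lemma linear_comp:
  "\<lbrakk>Vector_Spaces.linear s1 s2 f; Vector_Spaces.linear s2 s3 g\<rbrakk>
    \<Longrightarrow> Vector_Spaces.linear s1 s3 (\<lambda>x. g (f x))"
  by (simp add: Vector_Spaces.linear_iff)

lemma linear_coeff_comp:
  assumes "\<And>i. Vector_Spaces.linear s2 s3 (F i)" "\<And>i. Vector_Spaces.linear s1 s2 (G i)"
  shows "Vector_Spaces.linear s1 s3 (coeff_comp F G n)"
proof -
  have "vector_space_pair s1 s3"
    using assms[of 0] by (simp add: Vector_Spaces.linear_iff vector_space_pair_def)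
  then show ?thesis
    unfolding coeff_comp_def
    by (intro vector_space_pair.linear_compose_sum ballI linear_comp[OF assms(2,1)])
qed


section \<open>Structure-preserving pairs and equivalences up to degree n\<close>

context twisted_rota_baxter
begin

interpretation br: biadditive br by (rule bilinear_map_imp_biadditive[OF bilinear_br])
interpretation rL: biadditive rL by (rule bilinear_map_imp_biadditive[OF bilinear_rL])
interpretation rR: biadditive rR by (rule bilinear_map_imp_biadditive[OF bilinear_rR])
interpretation H: biadditive H by (rule bilinear_map_imp_biadditive[OF bilinear_H])
interpretation K: additive K by (rule linear_imp_additive[OF linear_K])

text \<open>The linear coefficient that an equivalence with element \<open>x\<close> prescribes on
  V.\<close>

definition psi :: "'g \<Rightarrow> 'v \<Rightarrow> 'v" where
  "psi x u = rL x u + H x (K u)"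

text \<open>All arguments are series, also for \<open>rL\<close> and \<open>rR\<close>, where
  equivalence asks only for constants: composing with a further map evaluates it at non-constant
  series.\<close>

definition compatible :: "('g fps \<Rightarrow> 'g fps) \<Rightarrow> ('v fps \<Rightarrow> 'v fps) \<Rightarrow> bool" where
  "compatible f g \<longleftrightarrow>
     (\<forall>y z. f (fps_bilin br y z) = fps_bilin br (f y) (f z)) \<and>
     (\<forall>y u. g (fps_bilin rL y u) = fps_bilin rL (f y) (g u)) \<and>
     (\<forall>y u. g (fps_bilin rR y u) = fps_bilin rR (f y) (g u)) \<and>
     (\<forall>y z. g (fps_bilin H y z) = fps_bilin H (f y) (f z))"

text \<open>An equivalence to the undeformed \<open>K\<close> whose intertwining relation is
  required only up to degree n, while compatibility with the structure holds in all degrees.\<close>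

definition stage ::
  "(nat \<Rightarrow> 'v \<Rightarrow> 'g) \<Rightarrow> nat \<Rightarrow> (nat \<Rightarrow> 'g \<Rightarrow> 'g) \<Rightarrow> (nat \<Rightarrow> 'v \<Rightarrow> 'v) \<Rightarrow> bool" where
  "stage Kt n \<phi> \<psi> \<longleftrightarrow>
     (\<forall>i. Vector_Spaces.linear sg sg (\<phi> i)) \<and>
     (\<forall>i. Vector_Spaces.linear sv sv (\<psi> i)) \<and>
     \<phi> 0 = (\<lambda>y. y) \<and> \<psi> 0 = (\<lambda>u. u) \<and>
     (\<exists>x. \<phi> 1 = br x \<and> \<psi> 1 = psi x) \<and>
     compatible (fps_lin \<phi>) (fps_lin \<psi>) \<and>
     (\<forall>k\<le>n. coeff_comp \<phi> Kt k = (\<lambda>u. K (\<psi> k u)))"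

lemma linear_br: "Vector_Spaces.linear sg sg (br x)"
  using bilinear_br by (simp add: bilinear_map_def)

lemma linear_psi: "Vector_Spaces.linear sv sv (psi x)"
  using bilinear_rL bilinear_H unfolding psi_def bilinear_map_def
  by (intro linear_add linear_comp[OF linear_K]) simp_all

lemma fps_lin_undeformed: "fps_lin undeformed w $ n = K (w $ n)"
proof -
  have "(\<Sum>i\<le>n. undeformed i (w $ (n - i))) = (\<Sum>i\<le>n. if i = 0 then K (w $ n) else 0)"
    by (intro sum.cong) (auto simp: undeformed_def)
  then show ?thesis by (simp add: fps_lin_def)
qed

lemma rota_baxter_fps:
  fixes q r
  defines "k \<equiv> fps_lin undeformed"
  shows "fps_bilin br (k q) (k r) =
    k (fps_bilin rL (k q) r + fps_bilin rR (k r) q + fps_bilin H (k q) (k r))"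
  \<comment> \<open>With the arguments of \<open>rR\<close> swapped, all four Cauchy sums run over
    the pairs \<open>q $ i\<close>, \<open>r $ (n - i)\<close>, and the identity for
    \<open>K\<close> applies termwise.\<close>
  unfolding fps_bilin_flip[of rR] k_def
  by (rule fps_ext)
     (simp add: fps_lin_undeformed fps_bilin_def rota_baxter K.sum flip: sum.distrib)

text \<open>For each of the four operations, the Nijenhuis conditions together with the Leibniz and
  representation identities supply the premises \<open>deriv\<close> and \<open>null\<close> of
  \<open>fps_bilin_derivation\<close>.\<close>

lemma compatible_Nij:
  assumes "compatible f g" "x \<in> Nij"
  shows "compatible (\<lambda>y. f y + fps_lin (monomial_map m (br x)) (f y))
    (\<lambda>u. g u + fps_lin (monomial_map m (psi x)) (g u))"
proof -
  have psi: "additive (psi x)"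
    by (rule linear_imp_additive[OF linear_psi])
  note nij = assms(2)[unfolded Nij_def mem_Collect_eq, rule_format]
  have "br x (br y z) = br (br x y) z + br y (br x z)" "br (br x y) (br x z) = 0" for y z
    using leibniz nij by blast+
  note 1 = fps_bilin_derivation[where f=br and a="br x" and b="br x" and c="br x",
    OF br.biadditive_axioms br.additive_right this]
  have "psi x (rL y u) = rL (br x y) u + rL y (psi x u)" "rL (br x y) (psi x u) = 0" for y u
    using nij by (simp_all add: psi_def rL_br rL.add_right)
  note 2 = fps_bilin_derivation[where f=rL and a="br x" and b="psi x" and c="psi x",
    OF rL.biadditive_axioms psi this]
  have "psi x (rR y u) = rR (br x y) u + rR y (psi x u)" "rR (br x y) (psi x u) = 0" for y u
    using nij by (simp_all add: psi_def rR_br rR.add_right)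
  note 3 = fps_bilin_derivation[where f=rR and a="br x" and b="psi x" and c="psi x",
    OF rR.biadditive_axioms psi this]
  have "psi x (H y z) = H (br x y) z + H y (br x z)" "H (br x y) (br x z) = 0" for y z
    using nij by (simp_all add: psi_def)
  note 4 = fps_bilin_derivation[where f=H and a="br x" and b="br x" and c="psi x",
    OF H.biadditive_axioms psi this]
  show ?thesis
    using assms(1) by (simp add: compatible_def 1 2 3 4)
qed

section \<open>The defect in the next degree and its removal\<close>

text \<open>Below, \<open>p = \<phi>\<^sub>t (K\<^sub>t u)\<close> and \<open>r = \<phi>\<^sub>t (K\<^sub>t v)\<close> agree with \<open>q = K (\<psi>\<^sub>t u)\<close> and
  \<open>s = K (\<psi>\<^sub>t v)\<close> below degree \<open>n + 1\<close>; subtracting the Rota-Baxter identity for \<open>K\<close>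
  from the transported one leaves \<open>d1 D = 0\<close> in degree \<open>n + 1\<close>.\<close>

lemma obstruction:
  assumes Kt: "formal_deformation Kt" and stage: "stage Kt n \<phi> \<psi>"
  shows "(\<lambda>u. coeff_comp \<phi> Kt (Suc n) u - K (\<psi> (Suc n) u)) \<in> Z1"
proof -
  define P where "P = coeff_comp \<phi> Kt"
  define D where "D u = P (Suc n) u - K (\<psi> (Suc n) u)" for u
  have lin: "\<And>i. Vector_Spaces.linear sg sg (\<phi> i)" "\<And>i. Vector_Spaces.linear sv sv (\<psi> i)"
      "\<And>i. Vector_Spaces.linear sv sg (Kt i)"
    using Kt stage by (auto simp: formal_deformation_def stage_def)
  have linP: "\<And>i. Vector_Spaces.linear sv sg (P i)"
    unfolding P_def by (rule linear_coeff_comp[OF lin(1,3)])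
  have linD: "Vector_Spaces.linear sv sg D"
    unfolding D_def by (intro linear_sub linP linear_comp[OF lin(2) linear_K])
  have \<psi>0: "\<psi> 0 = (\<lambda>u. u)" and comp: "compatible (fps_lin \<phi>) (fps_lin \<psi>)"
    and P: "\<And>k u. k \<le> n \<Longrightarrow> P k u = K (\<psi> k u)" and Kt0: "Kt 0 = K"
    using Kt stage by (auto simp: formal_deformation_def stage_def P_def)
  note add = linear_imp_additive[OF lin(1)] linear_imp_additive[OF lin(2)]
    linear_imp_additive[OF lin(3)] linear_imp_additive[OF linP]
  have "d1 D u v = 0" for u v
  proof -
    let ?u = "fps_const u" and ?v = "fps_const v" and ?k = "fps_lin Kt"
    \<comment> \<open>The bracket on V induced by the deformation; its constant term is
      \<open>brK u v\<close>.\<close>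
    define w where "w = fps_bilin rL (?k ?u) ?v + fps_bilin rR (?k ?v) ?u + fps_bilin H (?k ?u) (?k ?v)"
    define p where "p = fps_lin P ?u"
    define r where "r = fps_lin P ?v"
    define a where "a = fps_lin \<psi> ?u"
    define b where "b = fps_lin \<psi> ?v"
    define q where "q = fps_lin undeformed a"
    define s where "s = fps_lin undeformed b"
    have \<phi>Kt: "fps_lin \<phi> (?k x) = fps_lin P x" for x
      unfolding P_def by (rule fps_lin_comp[OF add(1)])
    have coeffs: "p $ i = P i u" "r $ i = P i v" "a $ i = \<psi> i u" "b $ i = \<psi> i v"
        "q $ i = K (\<psi> i u)" "s $ i = K (\<psi> i v)" for i
      unfolding p_def r_def a_def b_def q_def s_def fps_lin_undeformed
      by (simp_all add: fps_lin_const add)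
    have "fps_bilin br p r = fps_lin \<phi> (fps_bilin br (?k ?u) (?k ?v))"
      using comp by (simp add: compatible_def \<phi>Kt p_def r_def)
    also have "fps_bilin br (?k ?u) (?k ?v) = ?k w"
      using Kt by (simp add: formal_deformation_def Let_def w_def)
    finally have pr: "fps_bilin br p r = fps_lin P w"
      by (simp add: \<phi>Kt)
    have \<psi>w: "fps_lin \<psi> w = fps_bilin rL p b + fps_bilin rR r a + fps_bilin H p r"
      using comp by (simp add: w_def fps_lin_add add compatible_def \<phi>Kt p_def r_def a_def b_def)
    \<comment> \<open>Here \<open>q\<close> and \<open>s\<close> have constant terms
      \<open>K u\<close> and \<open>K v\<close> because \<open>\<psi> 0\<close> is the identity. The
      codomain stays general to cover both \<open>br\<close> and \<open>H\<close>.\<close>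
    have perturb: "fps_bilin f p r $ Suc n = fps_bilin f q s $ Suc n + f (D u) (K v) + f (K u) (D v)"
      if "biadditive f" for f :: "'g \<Rightarrow> 'g \<Rightarrow> 'c::ab_group_add"
      using biadditive.fps_bilin_perturb_last[OF that, of n p q r s]
      by (simp add: coeffs P \<psi>0 D_def)
    \<comment> \<open>The second factors \<open>b\<close> and \<open>a\<close> are the same on both
      sides, so only one correction survives.\<close>
    have perturb': "fps_bilin rL p b $ Suc n = fps_bilin rL q b $ Suc n + rL (D u) v"
        "fps_bilin rR r a $ Suc n = fps_bilin rR s a $ Suc n + rR (D v) u"
      using rL.fps_bilin_perturb_last[of n p q b b] rR.fps_bilin_perturb_last[of n r s a a]
      by (simp_all add: coeffs P \<psi>0 D_def rL.zero_right rR.zero_right)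
    have w0: "w $ 0 = brK u v"
      by (simp add: w_def fps_bilin_def fps_lin_def Kt0 brK_def)
    \<comment> \<open>\<open>P\<close> differs from K composed with \<open>\<psi>\<close> first at
      index \<open>Suc n\<close>, which meets only the constant term of \<open>w\<close>.\<close>
    have "fps_lin P w $ Suc n = K (fps_lin \<psi> w $ Suc n) + D (w $ 0)"
      by (simp add: fps_lin_def K.sum K.add P D_def)
    then have "fps_bilin br p r $ Suc n = K (fps_lin \<psi> w $ Suc n) + D (brK u v)"
      by (simp add: pr w0)
    moreover have "fps_bilin br q s $ Suc n = K ((fps_bilin rL q b + fps_bilin rR s a + fps_bilin H q s) $ Suc n)"
      unfolding q_def s_def rota_baxter_fps fps_lin_undeformed ..
    ultimately have "br (D u) (K v) + br (K u) (D v) =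
        K (rL (D u) v) + K (rR (D v) u) + K (H (D u) (K v)) + K (H (K u) (D v)) + D (brK u v)"
      by (simp add: perturb[OF br.biadditive_axioms] perturb[OF H.biadditive_axioms] perturb' \<psi>w K.add)
    then show "d1 D u v = 0"
      by (simp add: d1_def rhoL_bar_def rhoR_bar_def algebra_simps)
  qed
  with linD show ?thesis
    by (simp add: Z1_def D_def[abs_def] P_def fun_eq_iff)
qed

text \<open>Composing with the degree n + 1 perturbation given by \<open>x\<close> adds
  \<open>br x (K u)\<close> to one side and \<open>K (psi x u)\<close> to the other. Their
  difference is \<open>rhoR_bar u x\<close>, which cancels the defect \<open>d0 x u\<close>; lower
  degrees do not change.\<close>

lemma stage_Suc:
  assumes Kt: "formal_deformation Kt" and Z1: "Z1 \<subseteq> d0 ` Nij" and stage: "stage Kt n \<phi> \<psi>"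
  shows "\<exists>\<phi>' \<psi>'. stage Kt (Suc n) \<phi>' \<psi>' \<and> (\<forall>i\<le>n. \<phi>' i = \<phi> i \<and> \<psi>' i = \<psi> i)"
proof -
  obtain x where x: "x \<in> Nij"
    and D: "\<And>u. coeff_comp \<phi> Kt (Suc n) u - K (\<psi> (Suc n) u) = - rhoR_bar u x"
    using subsetD[OF Z1 obstruction[OF Kt stage]] by (auto simp: d0_def fun_eq_iff)
  define M where "M = monomial_map (Suc n) (br x)"
  define N where "N = monomial_map (Suc n) (psi x)"
  define \<phi>' where "\<phi>' i y = \<phi> i y + coeff_comp M \<phi> i y" for i y
  define \<psi>' where "\<psi>' i u = \<psi> i u + coeff_comp N \<psi> i u" for i u
  have lin: "\<And>i. Vector_Spaces.linear sg sg (\<phi> i)" "\<And>i. Vector_Spaces.linear sv sv (\<psi> i)"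
      "\<And>i. Vector_Spaces.linear sv sg (Kt i)"
    and \<phi>0: "\<phi> 0 = (\<lambda>y. y)" and \<psi>0: "\<psi> 0 = (\<lambda>u. u)" and Kt0: "Kt 0 = K"
    and comp: "compatible (fps_lin \<phi>) (fps_lin \<psi>)"
    and P: "\<And>k u. k \<le> n \<Longrightarrow> coeff_comp \<phi> Kt k u = K (\<psi> k u)"
    using Kt stage by (auto simp: formal_deformation_def stage_def)
  have linMN: "Vector_Spaces.linear sg sg (M i)" "Vector_Spaces.linear sv sv (N i)" for i
    using linear_br[of x] linear_psi[of x]
    by (cases "i = Suc n"; simp add: M_def N_def monomial_map_def[abs_def] Vector_Spaces.linear_iff module.scale_zero_right flip: module_iff_vector_space)+
  have coeffs: "\<phi>' i y = (if i \<le> n then \<phi> i y else \<phi> i y + br x (\<phi> (i - Suc n) y))"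
      "\<psi>' i u = (if i \<le> n then \<psi> i u else \<psi> i u + psi x (\<psi> (i - Suc n) u))" for i y u
    by (auto simp: \<phi>'_def \<psi>'_def M_def N_def coeff_comp_monomial_map)
  have lin': "Vector_Spaces.linear sg sg (\<phi>' i)" "Vector_Spaces.linear sv sv (\<psi>' i)" for i
    unfolding \<phi>'_def \<psi>'_def
    by (intro linear_add lin linear_coeff_comp[OF linMN(1) lin(1)],
        intro linear_add lin linear_coeff_comp[OF linMN(2) lin(2)])
  \<comment> \<open>As operators, \<open>\<phi>'\<close> and \<open>\<psi>'\<close> are the
    perturbations applied after \<open>\<phi>\<close> and \<open>\<psi>\<close>, the form treated in
    \<open>compatible_Nij\<close>.\<close>
  have "fps_lin \<phi>' = (\<lambda>y. fps_lin \<phi> y + fps_lin M (fps_lin \<phi> y))"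
    by (rule ext, subst fps_lin_comp[OF linear_imp_additive[OF linMN(1)]])
       (simp add: \<phi>'_def fps_lin_def fps_eq_iff sum.distrib)
  moreover have "fps_lin \<psi>' = (\<lambda>u. fps_lin \<psi> u + fps_lin N (fps_lin \<psi> u))"
    by (rule ext, subst fps_lin_comp[OF linear_imp_additive[OF linMN(2)]])
       (simp add: \<psi>'_def fps_lin_def fps_eq_iff sum.distrib)
  ultimately have comp': "compatible (fps_lin \<phi>') (fps_lin \<psi>')"
    using compatible_Nij[OF comp x, of "Suc n"] by (simp add: M_def N_def)
  \<comment> \<open>For n = 0 the new element is added to the old one, as \<open>br\<close> and
    \<open>psi\<close> are additive in it; for larger n degree 1 is untouched.\<close>
  have first: "\<exists>z. \<phi>' 1 = br z \<and> \<psi>' 1 = psi z"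
  proof -
    obtain z where z: "\<phi> 1 = br z" "\<psi> 1 = psi z"
      using stage by (auto simp: stage_def)
    show ?thesis
    proof (cases n)
      case 0
      have "\<phi>' 1 = br (z + x)" "\<psi>' 1 = psi (z + x)"
        using z \<phi>0 \<psi>0
        by (auto simp: coeffs fun_eq_iff 0 br.add_left psi_def rL.add_left H.add_left)
      then show ?thesis by blast
    next
      case (Suc m)
      with z show ?thesis by (auto simp: coeffs fun_eq_iff)
    qed
  qed
  have low: "coeff_comp \<phi>' Kt k u = coeff_comp \<phi> Kt k u" if "k \<le> n" for k u
    using that by (auto simp: coeff_comp_def coeffs intro!: sum.cong)
  have "coeff_comp \<phi>' Kt (Suc n) u = K (\<psi>' (Suc n) u)" for u
  proof -
    \<comment> \<open>Only \<open>\<phi>' (Suc n)\<close> differs from the old coefficient, and it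
      is applied to \<open>Kt 0 u = K u\<close>.\<close>
    have "coeff_comp \<phi>' Kt (Suc n) u = coeff_comp \<phi> Kt (Suc n) u + br x (K u)"
      by (simp add: coeff_comp_def coeffs \<phi>0 Kt0)
    also have "\<dots> = K (\<psi> (Suc n) u) + K (psi x u)"
      using D[of u] by (simp add: rhoR_bar_def psi_def K.add algebra_simps)
    finally show ?thesis by (simp add: coeffs \<psi>0 K.add)
  qed
  with low P have "\<forall>k\<le>Suc n. coeff_comp \<phi>' Kt k = (\<lambda>u. K (\<psi>' k u))"
    by (auto simp: le_Suc_eq fun_eq_iff coeffs)
  then have "stage Kt (Suc n) \<phi>' \<psi>'"
    using lin' comp' first by (simp add: stage_def coeffs fun_eq_iff \<phi>0 \<psi>0)
  moreover have "\<forall>i\<le>n. \<phi>' i = \<phi> i \<and> \<psi>' i = \<psi> i"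
    by (simp add: coeffs fun_eq_iff)
  ultimately show ?thesis by blast
qed

section \<open>The initial stage and the t-adic limit\<close>

lemma stage_0:
  assumes "formal_deformation Kt"
  shows "stage Kt 0 (monomial_map 0 (\<lambda>y. y)) (monomial_map 0 (\<lambda>u. u))"
proof -
  have id: "fps_lin (monomial_map 0 (\<lambda>y. y)) = (\<lambda>y :: 'b::ab_group_add fps. y)"
    by (auto simp: fun_eq_iff fps_eq_iff fps_lin_monomial_map)
  have "Vector_Spaces.linear sg sg (monomial_map 0 (\<lambda>y. y) i)"
      "Vector_Spaces.linear sv sv (monomial_map 0 (\<lambda>u. u) i)" for i
    \<comment> \<open>Linearity of \<open>K\<close> carries the vector space axioms for
      \<open>sg\<close> and \<open>sv\<close>.\<close>
    using linear_K
    by (cases i; simp add: monomial_map_def[abs_def] Vector_Spaces.linear_iff module.scale_zero_right flip: module_iff_vector_space)+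
  \<comment> \<open>The identity has zero linear term, so the element 0 serves.\<close>
  moreover have "br 0 = (\<lambda>y. 0)" "psi 0 = (\<lambda>u. 0)"
    by (auto simp: psi_def br.zero_left rL.zero_left H.zero_left)
  then have "monomial_map 0 (\<lambda>y. y) 1 = br 0 \<and> monomial_map 0 (\<lambda>u. u) 1 = psi 0"
    by (simp add: monomial_map_def[abs_def])
  moreover have "Kt 0 = K"
    using assms by (simp add: formal_deformation_def)
  ultimately show ?thesis
    unfolding stage_def
    by (simp add: id compatible_def coeff_comp_monomial_map) (auto simp: monomial_map_def coeff_comp_monomial_map fun_eq_iff)
qed

text \<open>Each identity for the limit is checked one degree at a time, where the limit agrees with
  a finite stage.\<close>

lemma rigid_if_Z1_subset:
  assumes Z1: "Z1 \<subseteq> d0 ` Nij"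
  shows rigid
  unfolding rigid_def
proof (intro allI impI)
  fix Kt assume Kt: "formal_deformation Kt"
  \<comment> \<open>Dependent choice is needed because each stage extends the particular one chosen
    before it.\<close>
  have "\<exists>S. \<forall>n. stage Kt n (fst (S n)) (snd (S n)) \<and>
      (\<forall>i\<le>n. fst (S (Suc n)) i = fst (S n) i \<and> snd (S (Suc n)) i = snd (S n) i)"
    by (rule dependent_nat_choice) (use stage_0[OF Kt] stage_Suc[OF Kt Z1] in force)+
  then obtain S where S: "\<And>n. stage Kt n (fst (S n)) (snd (S n))"
      "\<And>n i. i \<le> n \<Longrightarrow> fst (S (Suc n)) i = fst (S n) i \<and> snd (S (Suc n)) i = snd (S n) i"
    by blast
  define F where "F n = fst (S n)" for n
  define G where "G n = snd (S n)" for n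
  have FG: "\<And>n. stage Kt n (F n) (G n)"
    and FG_Suc: "\<And>n i. i \<le> n \<Longrightarrow> F (Suc n) i = F n i \<and> G (Suc n) i = G n i"
    using S by (simp_all add: F_def G_def)
  \<comment> \<open>Coefficient i is frozen from stage i on, so the diagonal is the limit.\<close>
  define \<phi> where "\<phi> i = F i i" for i
  define \<psi> where "\<psi> i = G i i" for i
  have stable: "\<phi> i = F n i" "\<psi> i = G n i" if "i \<le> n" for i n
    using that by (induction rule: dec_induct) (simp_all add: \<phi>_def \<psi>_def FG_Suc)
  have lin: "Vector_Spaces.linear sg sg (\<phi> i)" "Vector_Spaces.linear sv sv (\<psi> i)" for i
    using FG[of i] by (auto simp: stage_def \<phi>_def \<psi>_def)
  note add = linear_imp_additive[OF lin(1)] linear_imp_additive[OF lin(2)]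
  have nth: "fps_lin \<phi> y $ i = fps_lin (F n) y $ i" "fps_lin \<psi> u $ i = fps_lin (G n) u $ i"
    if "i \<le> n" for i n y u
    using that by (auto intro!: fps_lin_nth_cong stable)
  have comp: "compatible (fps_lin \<phi>) (fps_lin \<psi>)"
    unfolding compatible_def
  proof (intro conjI allI fps_ext)
    fix n y z u
    have "compatible (fps_lin (F n)) (fps_lin (G n))"
      using FG by (simp add: stage_def)
    note c = this[unfolded compatible_def]
    show "fps_lin \<phi> (fps_bilin br y z) $ n = fps_bilin br (fps_lin \<phi> y) (fps_lin \<phi> z) $ n"
      and "fps_lin \<psi> (fps_bilin rL y u) $ n = fps_bilin rL (fps_lin \<phi> y) (fps_lin \<psi> u) $ n"
      and "fps_lin \<psi> (fps_bilin rR y u) $ n = fps_bilin rR (fps_lin \<phi> y) (fps_lin \<psi> u) $ n"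
      and "fps_lin \<psi> (fps_bilin H y z) $ n = fps_bilin H (fps_lin \<phi> y) (fps_lin \<phi> z) $ n"
      using c by (simp_all add: nth[OF order.refl], (intro fps_bilin_nth_cong; simp add: nth)+)
  qed
  have "fps_lin \<phi> (fps_lin Kt w) = fps_lin undeformed (fps_lin \<psi> w)" for w
  proof (rule fps_ext)
    fix n
    have "coeff_comp \<phi> Kt i u = K (\<psi> i u)" if "i \<le> n" for i u
    proof -
      have "coeff_comp \<phi> Kt i u = coeff_comp (F i) Kt i u"
        by (auto simp: coeff_comp_def stable intro!: sum.cong)
      also have "\<dots> = K (\<psi> i u)"
        using FG[of i] by (simp add: stage_def \<psi>_def)
      finally show ?thesis .
    qed
    then show "fps_lin \<phi> (fps_lin Kt w) $ n = fps_lin undeformed (fps_lin \<psi> w) $ n"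
      by (simp add: fps_lin_comp[OF add(1)] fps_lin_undeformed) (simp add: fps_lin_def K.sum)
  qed
  \<comment> \<open>Degree 1 is settled at stage 1, which gives one element for both maps.\<close>
  moreover obtain x where "\<phi> 1 = br x" "\<psi> 1 = psi x"
    using FG[of 1] by (auto simp: stage_def \<phi>_def \<psi>_def)
  moreover have "\<phi> 0 = (\<lambda>y. y)" "\<psi> 0 = (\<lambda>u. u)"
    using FG[of 0] by (auto simp: stage_def \<phi>_def \<psi>_def)
  \<comment> \<open>The relations for \<open>rL\<close> and \<open>rR\<close> are specialised to
    constant series through \<open>fps_bilin_const\<close>.\<close>
  ultimately show "equivalent_deformations Kt undeformed"
    unfolding equivalent_deformations_def
    using lin comp
    by (intro exI[of _ x] exI[of _ \<phi>] exI[of _ \<psi>])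
       (simp add: compatible_def fun_eq_iff psi_def flip: rL.fps_bilin_const rR.fps_bilin_const)
qed

end

theorem theorem4p13:
  fixes sg :: "complex \<Rightarrow> 'g::ab_group_add \<Rightarrow> 'g"
    and br :: "'g \<Rightarrow> 'g \<Rightarrow> 'g"
    and sv :: "complex \<Rightarrow> 'v::ab_group_add \<Rightarrow> 'v"
    and rL rR :: "'g \<Rightarrow> 'v \<Rightarrow> 'v"
    and H :: "'g \<Rightarrow> 'g \<Rightarrow> 'v"
    and K :: "'v \<Rightarrow> 'g"
  assumes "leibniz_algebra sg br"
    and "leibniz_representation sg br sv rL rR"
    and "leibniz_2cocycle sg br sv rL rR H"
    and "twisted_rota_baxter sg br sv rL rR H K"
    and "twisted_rota_baxter.Z1 sg br sv rL rR H K =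
         twisted_rota_baxter.d0 br rL H K ` twisted_rota_baxter.Nij br rL rR H K"
  shows "twisted_rota_baxter.rigid sg br sv rL rR H K"
  using twisted_rota_baxter.rigid_if_Z1_subset[OF assms(4)] assms(5) by simp

end
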